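(* Every co-analytic Menger absolute Borel space is $\sigma$-compact.
   Context: All spaces are completely regular. A space is analytic if it is a continuous image of the space $\mathbb{P}$ of irrationals; $X$ is co-analytic if $\beta X\setminus X$ is analytic. $X$ is absolute Borel if $X$ belongs to the $\sigma$-algebra of subsets of $\beta X$ generated by the closed subsets of $\beta X$. $X$ is Menger if for every sequence $(\mathcal{U}_n)_{n<\omega}$ of open covers there are finite $\mathcal{V}_n\subseteq\mathcal{U}_n$ with $\bigcup_n\mathcal{V}_n$ covering $X$. *)

theory Defs
  imports "HOL-Analysis.Analysis"
begin

definition tychonoff_space :: "'a topology \<Rightarrow> bool" where
  "tychonoff_space X \<longleftrightarrow> completely_regular_space X \<and> Hausdorff_space X"

text \<open>The Baire space \<open>\<omega>^\<omega>\<close>, homeomorphic to the space \<open>\<bbbP>\<close> of irrationals.\<close>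
definition baire_space :: "(nat \<Rightarrow> nat) topology" where
  "baire_space = product_topology (\<lambda>_. discrete_topology (UNIV :: nat set)) UNIV"

text \<open>A subset \<open>A\<close> of a space \<open>K\<close> is analytic (as a subspace) if it is a continuous
  image of the irrationals; the empty set is counted as analytic (standard convention).\<close>
definition analytic_in :: "'b topology \<Rightarrow> 'b set \<Rightarrow> bool" where
  "analytic_in K A \<longleftrightarrow> A \<subseteq> topspace K \<and>
     (A = {} \<or> (\<exists>f. continuous_map baire_space (subtopology K A) f \<and>
                     f ` topspace baire_space = A))"

definition stone_cech :: "'a topology \<Rightarrow> 'b topology \<Rightarrow> ('a \<Rightarrow> 'b) \<Rightarrow> bool" where
  "stone_cech X K e \<longleftrightarrow>
     compact_space K \<and> Hausdorff_space K \<and> embedding_map X K e \<and>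
     K closure_of (e ` topspace X) = topspace K \<and>
     (\<forall>f. continuous_map X (top_of_set {0..1::real}) f \<longrightarrow>
        (\<exists>g. continuous_map K (top_of_set {0..1::real}) g \<and>
             (\<forall>x\<in>topspace X. g (e x) = f x)))"

definition co_analytic :: "'b itself \<Rightarrow> 'a topology \<Rightarrow> bool" where
  "co_analytic _ X \<longleftrightarrow>
     (\<exists>(K::'b topology) e. stone_cech X K e \<and> analytic_in K (topspace K - e ` topspace X))"

definition absolute_borel :: "'b itself \<Rightarrow> 'a topology \<Rightarrow> bool" where
  "absolute_borel _ X \<longleftrightarrow>
     (\<exists>(K::'b topology) e. stone_cech X K e \<and>
        e ` topspace X \<in> sigma_sets (topspace K) {C. closedin K C})"

definition menger_space :: "'a topology \<Rightarrow> bool" where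
  "menger_space X \<longleftrightarrow>
     (\<forall>U :: nat \<Rightarrow> 'a set set.
        (\<forall>n. (\<forall>W\<in>U n. openin X W) \<and> topspace X \<subseteq> \<Union>(U n)) \<longrightarrow>
        (\<exists>V. (\<forall>n. finite (V n) \<and> V n \<subseteq> U n) \<and> topspace X \<subseteq> (\<Union>n. \<Union>(V n))))"

definition sigma_compact_space :: "'a topology \<Rightarrow> bool" where
  "sigma_compact_space X \<longleftrightarrow>
     (\<exists>C :: nat \<Rightarrow> 'a set. (\<forall>n. compactin X (C n)) \<and> (\<Union>n. C n) = topspace X)"

end

theory Submission
  imports Defs
begin

text \<open>
  Such a space is in fact compact. Let \<open>K\<close> be its Stone--Cech compactification and suppose that
  some \<open>z \<in> K\<close> lies outside \<open>X\<close>. The Menger space \<open>X\<close> is Lindelof, and the remainder, being a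
  continuous image of a second countable space, is hereditarily Lindelof; so \<open>K - {z}\<close> is
  Lindelof. Hence \<open>z\<close> is the only zero of some continuous \<open>k \<ge> 0\<close> on \<open>K\<close>. Composing \<open>k\<close> with a
  function on \<open>{0<..}\<close> that oscillates near \<open>0\<close> along the values of \<open>k\<close> on \<open>X\<close> yields a bounded
  continuous function on \<open>X\<close> that has no limit at \<open>z\<close>, contradicting the extension property.
\<close>

section \<open>Lindelof properties of Menger spaces and of analytic sets\<close>

lemma menger_imp_Lindelof_space:
  assumes "menger_space X"
  shows "Lindelof_space X"
  unfolding Lindelof_space_alt
proof (intro allI impI)
  fix \<U> assume \<U>: "(\<forall>U\<in>\<U>. openin X U) \<and> topspace X \<subseteq> \<Union>\<U>"
  with assms[unfolded menger_space_def, rule_format, of "\<lambda>_. \<U>"]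
  obtain V :: "nat \<Rightarrow> _" where V: "\<And>n. finite (V n)" "\<And>n. V n \<subseteq> \<U>" "topspace X \<subseteq> (\<Union>n. \<Union>(V n))"
    by blast
  have "countable (\<Union>n. V n)"
    using V(1) by (intro countable_UN) (auto intro: countable_finite)
  moreover have "(\<Union>n. V n) \<subseteq> \<U>"
    using V(2) by (rule UN_least)
  moreover have "topspace X \<subseteq> \<Union>(\<Union>n. V n)"
    using V(3) by (fastforce simp: subset_iff)
  ultimately show "\<exists>\<V>. countable \<V> \<and> \<V> \<subseteq> \<U> \<and> topspace X \<subseteq> \<Union>\<V>"
    by blast
qed

text \<open>This makes the second countability of the type \<open>nat \<Rightarrow> nat\<close>
  available for the domain of an analytic parametrisation.\<close>

lemma baire_space_eq_euclidean: "baire_space = euclidean"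
proof -
  have "discrete_topology (UNIV :: nat set) = euclidean"
    by (simp add: topology_eq open_discrete)
  then show ?thesis
    by (simp add: baire_space_def euclidean_product_topology)
qed

lemma Lindelof_space_top_of_set:
  fixes S :: "'a::second_countable_topology set"
  shows "Lindelof_space (top_of_set S)"
  unfolding Lindelof_space_def
proof (intro allI impI)
  fix \<U> assume "(\<forall>U\<in>\<U>. openin (top_of_set S) U) \<and> \<Union>\<U> = topspace (top_of_set S)"
  then show "\<exists>\<V>. countable \<V> \<and> \<V> \<subseteq> \<U> \<and> \<Union>\<V> = topspace (top_of_set S)"
    by (metis Lindelof_openin)
qed

text \<open>The preimage of \<open>B\<close> is a subset of a second countable space, hence
  Lindelof, and the parametrisation maps it onto \<open>B\<close>. Arbitrary subsets are allowed
  because the result will be applied to a remainder with one point removed.\<close>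

lemma Lindelof_space_subtopology_analytic:
  fixes K :: "'a topology"
  assumes "analytic_in K A" "B \<subseteq> A"
  shows "Lindelof_space (subtopology K B)"
proof (cases "A = {}")
  case True
  with assms show ?thesis
    by (intro Lindelof_space_topspace_empty) auto
next
  case False
  then obtain f :: "(nat \<Rightarrow> nat) \<Rightarrow> 'a" where f: "continuous_map euclidean (subtopology K A) f" "range f = A" and "A \<subseteq> topspace K"
    using assms(1) unfolding analytic_in_def baire_space_eq_euclidean topspace_euclidean by metis
  show ?thesis
  proof (rule Lindelof_space_continuous_map_image)
    show "Lindelof_space (top_of_set (f -` B))"
      by (rule Lindelof_space_top_of_set)
    show "continuous_map (top_of_set (f -` B)) (subtopology K B) f"
      using f(1) by (auto simp: continuous_map_in_subtopology continuous_map_from_subtopology)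
    show "f ` topspace (top_of_set (f -` B)) = topspace (subtopology K B)"
      using f(2) assms(2) \<open>A \<subseteq> topspace K\<close> by auto
  qed
qed

section \<open>Auxiliary functions: one with a single zero, one that oscillates\<close>

lemma continuous_map_suminf:
  fixes g :: "nat \<Rightarrow> 'a \<Rightarrow> 'b::banach"
  assumes cont: "\<And>n. continuous_map X euclidean (g n)"
    and bound: "\<And>n x. x \<in> topspace X \<Longrightarrow> norm (g n x) \<le> M n" and "summable M"
  shows "continuous_map X euclidean (\<lambda>x. \<Sum>n. g n x)"
proof -
  have unif: "uniform_limit (topspace X) (\<lambda>n x. \<Sum>i<n. g i x) (\<lambda>x. \<Sum>n. g n x) sequentially"
    using bound \<open>summable M\<close> by (rule Weierstrass_m_test)
  \<comment> \<open>\<open>Met_TC.mtopology\<close> is the euclidean topology seen as a metric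
    topology, so that the uniform limit theorem for metric spaces applies to the partial
    sums.\<close>
  have "continuous_map X Met_TC.mtopology (\<lambda>x. \<Sum>n. g n x)"
  proof (rule Met_TC.continuous_map_uniform_limit)
    show "\<forall>\<^sub>F n in sequentially. continuous_map X Met_TC.mtopology (\<lambda>x. \<Sum>i<n. g i x)"
      using cont by (auto intro!: always_eventually continuous_map_sum)
    show "\<forall>\<^sub>F n in sequentially. \<forall>x\<in>topspace X. (\<Sum>n. g n x) \<in> UNIV \<and> dist (\<Sum>i<n. g i x) (\<Sum>n. g n x) < \<epsilon>"
      if "0 < \<epsilon>" for \<epsilon>
      using unif that by (simp add: uniform_limit_iff)
  qed auto
  then show ?thesis
    by simp
qed

text \<open>The positivity sets of functions vanishing at \<open>z\<close> cover the rest of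
  \<open>K\<close>. Countably many of them suffice, and a weighted sum of the corresponding
  functions is positive exactly off \<open>z\<close>.\<close>

lemma Lindelof_complement_imp_unique_zero:
  assumes "completely_regular_space K" "Hausdorff_space K" "z \<in> topspace K"
    and Lin: "Lindelof_space (subtopology K (topspace K - {z}))"
  obtains k :: "'a \<Rightarrow> real" where "continuous_map K euclidean k" "k z = 0"
    "\<And>y. y \<in> topspace K \<Longrightarrow> y \<noteq> z \<Longrightarrow> 0 < k y"
proof -
  define G where "G = {g. continuous_map K (top_of_set {0..1::real}) g \<and> g z = 0}"
  have G01: "g y \<in> {0..1}" if "g \<in> G" "y \<in> topspace K" for g y
    using that continuous_map_image_subset_topspace[of K "top_of_set {0..1}" g]
    by (auto simp: G_def)
  have Gcont: "continuous_map K euclidean g" if "g \<in> G" for g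
    using that by (auto simp: G_def continuous_map_in_subtopology)
  \<comment> \<open>Complete regularity separates \<open>z\<close> from the closed set
    \<open>{y}\<close>.\<close>
  have ex: "\<exists>g\<in>G. g y = 1" if "y \<in> topspace K" "y \<noteq> z" for y
  proof -
    have "closedin K {y}"
      using assms(2) that(1) closedin_Hausdorff_singleton by fastforce
    then show ?thesis
      using assms(1,3) that unfolding completely_regular_space_def G_def by force
  qed
  define P where "P g = {y \<in> topspace K. 0 < g y}" for g :: "'a \<Rightarrow> real"
  have "\<exists>\<V>. countable \<V> \<and> \<V> \<subseteq> P ` G \<and>
      \<Union>\<V> = topspace (subtopology K (topspace K - {z}))"
  proof (rule Lindelof_spaceD[OF Lin])
    fix U assume "U \<in> P ` G"
    then obtain g where g: "g \<in> G" "U = P g" by blast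
    then have "openin K U"
      using openin_continuous_map_preimage[OF Gcont[OF g(1)], of "{0<..}"] by (simp add: P_def)
    moreover have "U \<subseteq> topspace K - {z}"
      using g by (auto simp: P_def G_def)
    ultimately show "openin (subtopology K (topspace K - {z})) U"
      by (metis openin_subtopology_alt image_eqI inf.absorb2 mem_Collect_eq)
  next
    show "\<Union> (P ` G) = topspace (subtopology K (topspace K - {z}))"
      using ex by (force simp: P_def G_def)
  qed
  moreover have "topspace (subtopology K (topspace K - {z})) = topspace K - {z}"
    by auto
  ultimately obtain \<V> where \<V>: "countable \<V>" "\<V> \<subseteq> P ` G" "\<Union>\<V> = topspace K - {z}"
    by metis
  then obtain C where "countable C" "C \<subseteq> G" "\<V> = P ` C"
    by (meson countable_subset_image)
  with \<V>(3) have C: "\<Union> (P ` C) = topspace K - {z}"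
    by simp
  \<comment> \<open>Adding the zero function keeps the enumerated set nonempty even if
    \<open>C\<close> is empty, as happens when \<open>z\<close> is the only point of
    \<open>K\<close>.\<close>
  define g where "g = from_nat_into (insert (\<lambda>_. 0) C)"
  have g: "range g = insert (\<lambda>_. 0) C"
    unfolding g_def using \<open>countable C\<close> by (intro range_from_nat_into) auto
  have "(\<lambda>_. 0) \<in> G"
    by (auto simp: G_def continuous_map_in_subtopology)
  with g \<open>C \<subseteq> G\<close> have gG: "g n \<in> G" for n
    by (metis insert_subset rangeI subsetD)
  \<comment> \<open>Each \<open>g n\<close> takes values in [0,1], so the geometric weights dominate
    the series uniformly.\<close>
  define k where "k y = (\<Sum>n::nat. (1/2) ^ n * g n y)" for y
  have bd: "\<bar>(1/2) ^ n * g n y\<bar> \<le> (1/2) ^ n" if "y \<in> topspace K" for n y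
    using G01[OF gG that, of n] by (simp add: abs_mult mult_le_one)
  have summ: "summable (\<lambda>n. (1/2) ^ n * g n y)" if "y \<in> topspace K" for y
    by (rule summable_comparison_test'[of "\<lambda>n. (1/2) ^ n"]) (use bd[OF that] in auto)
  show thesis
  proof
    show "continuous_map K euclidean k"
      unfolding k_def
      by (rule continuous_map_suminf[where M = "\<lambda>n. (1/2) ^ n"])
         (use bd Gcont[OF gG] in \<open>auto intro!: continuous_map_real_mult\<close>)
    show "k z = 0"
      using gG by (simp add: k_def G_def)
    fix y assume y: "y \<in> topspace K" "y \<noteq> z"
    with C obtain h where "h \<in> C" "0 < h y"
      by (auto simp: P_def)
    with g obtain n where "0 < g n y"
      by (metis insertCI rangeE)
    then show "0 < k y"
      unfolding k_def using G01[OF gG y(1)] by (intro suminf_pos2[OF summ[OF y(1)], of n]) auto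
  qed
qed

text \<open>Choose a strictly decreasing sequence in \<open>T\<close> tending to 0. A Urysohn
  function built from distances is 0 at its even terms and 1 at its odd terms.\<close>

lemma oscillating_function:
  fixes T :: "real set"
  assumes pos: "\<And>t. t \<in> T \<Longrightarrow> 0 < t" and small: "\<And>\<delta>. 0 < \<delta> \<Longrightarrow> \<exists>t\<in>T. t < \<delta>"
  obtains \<phi> :: "real \<Rightarrow> real" where "continuous_on {0<..} \<phi>" "\<And>t. \<phi> t \<in> {0..1}"
    "\<And>\<delta>. 0 < \<delta> \<Longrightarrow> \<exists>t\<in>T. t < \<delta> \<and> \<phi> t = 0"
    "\<And>\<delta>. 0 < \<delta> \<Longrightarrow> \<exists>t\<in>T. t < \<delta> \<and> \<phi> t = 1"
proof -
  \<comment> \<open>The bound by the reciprocals forces convergence to 0; the strict decrease makes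
    the terms distinct.\<close>
  have "\<exists>t. \<forall>n. (t n \<in> T \<and> t n < 1 / real (Suc n)) \<and> t (Suc n) < t n"
  proof (rule dependent_nat_choice)
    show "\<exists>x. x \<in> T \<and> x < 1 / real (Suc 0)"
      using small[of 1] by auto
    show "\<exists>y. (y \<in> T \<and> y < 1 / real (Suc (Suc n))) \<and> y < x"
      if "x \<in> T \<and> x < 1 / real (Suc n)" for x n
      using small[of "min x (1 / real (Suc (Suc n)))"] pos that by auto
  qed
  then obtain t where t: "\<And>n. t n \<in> T" "\<And>n. t n < 1 / real (Suc n)" "\<And>n. t (Suc n) < t n"
    by blast
  have inj: "inj t"
  proof -
    have "strict_mono (\<lambda>n. - t n)"
      using t(3) by (simp add: strict_mono_Suc_iff)
    then show ?thesis
      by (simp add: inj_on_def strict_mono_eq[symmetric])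
  qed
  have lim: "t \<longlonglongrightarrow> 0"
    by (rule tendsto_sandwich[of "\<lambda>_. 0" _ _ "\<lambda>n. 1 / real (Suc n)"])
       (use t pos LIMSEQ_Suc[OF lim_1_over_n[where 'a = real]]
         in \<open>auto intro!: always_eventually less_imp_le\<close>)
  \<comment> \<open>Including the limit 0 makes both sets closed. Their only common point is then 0,
    which lies outside the domain \<open>{0<..}\<close>.\<close>
  define A B where "A = insert 0 (range (\<lambda>n. t (2 * n)))"
    and "B = insert 0 (range (\<lambda>n. t (Suc (2 * n))))"
  have closed: "closed A" "closed B"
    unfolding A_def B_def
    by (intro compact_imp_closed compact_sequence_with_limit filterlim_compose[OF lim]
        filterlim_subseq; simp add: strict_mono_def)+
  have disj: "A \<inter> B \<subseteq> {0}"
    using inj by (auto simp: A_def B_def inj_eq double_not_eq_Suc_double)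
  define \<phi> where "\<phi> s = infdist s A / (infdist s A + infdist s B)" for s
  have denom: "0 < infdist s A + infdist s B" if "0 < s" for s
  proof -
    have "s \<notin> A \<or> s \<notin> B"
      using disj that by auto
    moreover have "A \<noteq> {}" "B \<noteq> {}"
      by (simp_all add: A_def B_def)
    ultimately have "0 < infdist s A \<or> 0 < infdist s B"
      using closed infdist_pos_not_in_closed by blast
    then show ?thesis
      using infdist_nonneg[of s A] infdist_nonneg[of s B] by linarith
  qed
  have "0 < t n" for n
    using pos t(1) by blast
  have \<phi>0: "\<phi> (t (2 * n)) = 0" for n
    by (simp add: \<phi>_def A_def)
  have \<phi>1: "\<phi> (t (Suc (2 * n))) = 1" for n
  proof -
    have "infdist (t (Suc (2 * n))) B = 0"
      by (simp add: B_def)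
    with denom[OF \<open>0 < t (Suc (2 * n))\<close>] show ?thesis
      by (simp add: \<phi>_def)
  qed
  have tiny: "\<exists>N. \<forall>n\<ge>N. t n < \<delta>" if "0 < \<delta>" for \<delta>
    using order_tendstoD(2)[OF lim that] by (simp add: eventually_sequentially)
  show thesis
  proof
    show "continuous_on {0<..} \<phi>"
      unfolding \<phi>_def using denom by (intro continuous_intros) fastforce
    \<comment> \<open>The bound holds for all reals: at 0 both distances vanish, and division by
      zero gives 0.\<close>
    show "\<phi> s \<in> {0..1}" for s
      by (auto simp: \<phi>_def infdist_nonneg divide_le_eq_1 add_nonneg_nonneg)
         (smt (verit) infdist_nonneg)
    fix \<delta> :: real assume "0 < \<delta>"
    then obtain N where N: "\<And>n. n \<ge> N \<Longrightarrow> t n < \<delta>"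
      using tiny by blast
    show "\<exists>s\<in>T. s < \<delta> \<and> \<phi> s = 0"
      using N[of "2 * N"] \<phi>0[of N] t(1) by auto
    show "\<exists>s\<in>T. s < \<delta> \<and> \<phi> s = 1"
      using N[of "Suc (2 * N)"] \<phi>1[of N] t(1) by auto
  qed
qed

section \<open>Extension of functions and the Stone--Cech remainder\<close>

text \<open>On the compact complement of \<open>W\<close>, if nonempty, \<open>k\<close> attains a
  positive minimum, which serves as \<delta>. When \<open>k\<close> has a unique zero, smallness of
  \<open>k\<close> thus forces closeness to that zero.\<close>

lemma compact_unique_zero_neighbourhood:
  fixes k :: "'a \<Rightarrow> real"
  assumes "compact_space K" "continuous_map K euclidean k" "openin K W"
    and pos: "\<And>y. y \<in> topspace K - W \<Longrightarrow> 0 < k y"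
  obtains \<delta> where "0 < \<delta>" "\<And>y. y \<in> topspace K \<Longrightarrow> k y < \<delta> \<Longrightarrow> y \<in> W"
proof (cases "topspace K - W = {}")
  case True
  then show thesis
    using that[of 1] by auto
next
  case False
  have "compactin K (topspace K - W)"
    using assms(1,3) by (simp add: closedin_compact_space closedin_diff)
  then have "compact (k ` (topspace K - W))"
    using assms(2) image_compactin by fastforce
  with False obtain y where "y \<in> topspace K - W" "\<And>x. x \<in> topspace K - W \<Longrightarrow> k y \<le> k x"
    using compact_attains_inf[of "k ` (topspace K - W)"] by auto
  then show thesis
    using that[of "k y"] pos by (meson DiffI not_le)
qed

lemma stone_cech_remainder_not_Lindelof_complement:
  assumes sc: "stone_cech X K e" and z: "z \<in> topspace K - e ` topspace X"
  shows "\<not> Lindelof_space (subtopology K (topspace K - {z}))"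
proof
  assume "Lindelof_space (subtopology K (topspace K - {z}))"
  moreover have K: "compact_space K" "Hausdorff_space K"
    and emb: "embedding_map X K e" and dense: "K closure_of (e ` topspace X) = topspace K"
    and ext: "\<And>f. continuous_map X (top_of_set {0..1::real}) f \<Longrightarrow>
        \<exists>g. continuous_map K (top_of_set {0..1::real}) g \<and> (\<forall>x\<in>topspace X. g (e x) = f x)"
    using sc by (auto simp: stone_cech_def)
  moreover have "completely_regular_space K"
    using K by (simp add: compact_Hausdorff_or_regular_imp_normal_space
        normal_imp_completely_regular_space Hausdorff_imp_t1_space)
  ultimately obtain k where k: "continuous_map K euclideanreal k" "k z = 0"
    "\<And>y. y \<in> topspace K \<Longrightarrow> y \<noteq> z \<Longrightarrow> 0 < k y"
    using Lindelof_complement_imp_unique_zero z by (metis DiffD1)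
  have e: "continuous_map X K e"
    using emb homeomorphic_imp_continuous_map continuous_map_into_fulltopology
    unfolding embedding_map_def by blast
  then have ein: "e x \<in> topspace K" if "x \<in> topspace X" for x
    using that continuous_map_image_subset_topspace by fastforce
  \<comment> \<open>These values are positive because \<open>z\<close> is outside the image of
    \<open>X\<close>, and they come arbitrarily close to 0 because that image is dense in
    \<open>K\<close>.\<close>
  define T where "T = (\<lambda>x. k (e x)) ` topspace X"
  have Tpos: "0 < t" if "t \<in> T" for t
    using that k(3) ein z by (force simp: T_def)
  have "\<exists>t\<in>T. t < \<delta>" if "0 < \<delta>" for \<delta>
  proof -
    have "openin K {y \<in> topspace K. k y < \<delta>}"
      using openin_continuous_map_preimage[OF k(1), of "{..<\<delta>}"] by simp
    moreover have "z \<in> K closure_of (e ` topspace X)"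
      using dense z by simp
    moreover have "z \<in> {y \<in> topspace K. k y < \<delta>}"
      using that k(2) z by simp
    ultimately have "\<exists>y. y \<in> e ` topspace X \<and> y \<in> {y \<in> topspace K. k y < \<delta>}"
      by (meson in_closure_of)
    then show ?thesis
      by (auto simp: T_def)
  qed
  then obtain \<phi> where \<phi>: "continuous_on {0<..} \<phi>" "\<And>t. \<phi> t \<in> {0..1::real}"
    "\<And>\<delta>. 0 < \<delta> \<Longrightarrow> \<exists>t\<in>T. t < \<delta> \<and> \<phi> t = 0"
    "\<And>\<delta>. 0 < \<delta> \<Longrightarrow> \<exists>t\<in>T. t < \<delta> \<and> \<phi> t = 1"
    using oscillating_function[OF Tpos] by blast
  \<comment> \<open>The codomain is narrowed to the positive reals, where \<phi> is known to be
    continuous.\<close>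
  have "continuous_map X (top_of_set {0<..}) (k \<circ> e)"
    using continuous_map_compose[OF e k(1)] Tpos
    by (auto simp: continuous_map_in_subtopology T_def)
  then have "continuous_map X (top_of_set {0..1}) (\<phi> \<circ> (k \<circ> e))"
    by (rule continuous_map_compose) (use \<phi>(1,2) in \<open>auto simp: continuous_map_in_subtopology\<close>)
  then obtain g where g: "continuous_map K (top_of_set {0..1::real}) g"
    and gx: "\<And>x. x \<in> topspace X \<Longrightarrow> g (e x) = \<phi> (k (e x))"
    using ext by force
  have gcont: "continuous_map K euclidean g"
    using g by (simp add: continuous_map_in_subtopology)
  \<comment> \<open>If \<open>g z\<close> differed from \<open>c\<close>, then \<open>g\<close>
    would avoid \<open>c\<close> on a neighbourhood of \<open>z\<close>, hence wherever
    \<open>k\<close> is small enough; but \<phi> takes the value \<open>c\<close> at arbitrarily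
    small members of \<open>T\<close>. Taking \<open>c\<close> to be 0 and then 1 gives the
    contradiction.\<close>
  have g_eq: "g z = c" if c: "\<And>\<delta>. 0 < \<delta> \<Longrightarrow> \<exists>t\<in>T. t < \<delta> \<and> \<phi> t = c" for c
  proof (rule ccontr)
    define W where "W = {y \<in> topspace K. g y \<in> - {c}}"
    assume "g z \<noteq> c"
    then have "z \<in> W"
      using z by (simp add: W_def)
    moreover have "openin K W"
      unfolding W_def by (rule openin_continuous_map_preimage[OF gcont]) (simp add: open_Compl)
    moreover have "0 < k y" if "y \<in> topspace K - W" for y
      using that k(3)[of y] \<open>z \<in> W\<close> by blast
    ultimately obtain \<delta> where \<delta>: "0 < \<delta>" "\<And>y. y \<in> topspace K \<Longrightarrow> k y < \<delta> \<Longrightarrow> y \<in> W"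
      using compact_unique_zero_neighbourhood[OF K(1) k(1)] by metis
    obtain x where x: "x \<in> topspace X" "k (e x) < \<delta>" "\<phi> (k (e x)) = c"
      using c[OF \<delta>(1)] unfolding T_def by blast
    have "e x \<in> W"
      using \<delta>(2)[OF ein] x(1,2) by blast
    then show False
      using gx x(1,3) by (simp add: W_def)
  qed
  show False
    using g_eq[OF \<phi>(3)] g_eq[OF \<phi>(4)] by simp
qed

text \<open>A remainder point \<open>z\<close> would make \<open>K\<close> minus \<open>z\<close>
  the union of two Lindelof pieces, the copy of \<open>X\<close> and the rest of the remainder. So
  the remainder is empty, and \<open>e\<close> identifies \<open>X\<close> with the compact space
  \<open>K\<close>.\<close>

lemma co_analytic_Lindelof_imp_compact_space:
  fixes X :: "'a topology"
  assumes "co_analytic TYPE('b) X" "Lindelof_space X"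
  shows "compact_space X"
proof -
  obtain K :: "'b topology" and e where sc: "stone_cech X K e"
    and an: "analytic_in K (topspace K - e ` topspace X)"
    using assms by (auto simp: co_analytic_def)
  have hom: "homeomorphic_map X (subtopology K (e ` topspace X)) e" and "compact_space K"
    using sc by (auto simp: stone_cech_def embedding_map_def)
  then have sub: "e ` topspace X \<subseteq> topspace K"
    by (metis homeomorphic_imp_surjective_map inf_le1 topspace_subtopology)
  have "topspace K - e ` topspace X = {}"
  proof (rule ccontr)
    assume "topspace K - e ` topspace X \<noteq> {}"
    then obtain z where z: "z \<in> topspace K - e ` topspace X"
      by blast
    define \<C> where "\<C> = {e ` topspace X, topspace K - e ` topspace X - {z}}"
    have "Lindelof_space (subtopology K S)" if "S \<in> \<C>" for S
    proof -
      have "Lindelof_space (subtopology K (e ` topspace X))"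
        by (rule Lindelof_space_continuous_map_image[OF assms(2)
              homeomorphic_imp_continuous_map[OF hom] homeomorphic_imp_surjective_map[OF hom]])
      with that show ?thesis
        using Lindelof_space_subtopology_analytic[OF an] by (auto simp: \<C>_def)
    qed
    then have "Lindelof_space (subtopology K (\<Union>\<C>))"
      by (intro Lindelof_space_Union) (auto simp: \<C>_def)
    moreover have "\<Union>\<C> = topspace K - {z}"
      using z sub by (auto simp: \<C>_def)
    ultimately show False
      using stone_cech_remainder_not_Lindelof_complement[OF sc z] by simp
  qed
  then have "subtopology K (e ` topspace X) = K"
    using sub by (metis Diff_eq_empty_iff subset_antisym subtopology_topspace)
  with hom \<open>compact_space K\<close> show ?thesis
    by (metis homeomorphic_compact_space homeomorphic_map_imp_homeomorphic_space)
qed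

theorem theorem3p16:
  fixes X :: "'a topology"
  assumes "tychonoff_space X"
    and "co_analytic TYPE('b) X"
    and "menger_space X"
    and "absolute_borel TYPE('b) X"
  shows "sigma_compact_space X"
proof -
  have "compact_space X"
    using assms(2,3) menger_imp_Lindelof_space co_analytic_Lindelof_imp_compact_space by blast
  then show ?thesis
    \<comment> \<open>The constant sequence with value the whole space is a compact cover.\<close>
    unfolding sigma_compact_space_def compact_space_def by (intro exI[of _ "\<lambda>_. topspace X"]) auto
qed

end
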